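(* Let $t,k,v$ be positive integers with $k\ge t\ge 2$ and $v\ge 2$, and let $p=1/v^t$. Let \[ m=\frac{1}{\log(1-p)}\left(W_{-1}\!\left(\frac{-e(1-p)^{v^t}}{2\binom{k}{t}}\right)-(v^t-1)\log(1-p)-1\right). \] Then \[ \mathsf{CAN}_2(t,k,v)\le m+2\binom{k}{t}v^t\left((1-p)^m+mp(1-p)^{m-1}\right). \]
   Context: A covering array $\mathsf{CA}_\lambda(N;t,k,v)$ is an $N\times k$ array with entries from an alphabet $\Sigma$ of size $v$ such that for every set of $t$ distinct columns and every tuple $x\in\Sigma^t$, the tuple $x$ occurs as a row of the $N\times t$ subarray formed by those columns at least $\lambda$ times. $\mathsf{CAN}_\lambda(t,k,v)$ is the smallest $N$ for which a $\mathsf{CA}_\lambda(N;t,k,v)$ exists. $\log$ is the natural logarithm. $W_{-1}$ is the lower real branch of the Lambert $W$ function: for $-1/e\le x<0$, $W_{-1}(x)$ is the unique real $w\le -1$ with $we^w=x$. *)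

theory Defs
  imports "HOL-Analysis.Analysis"
begin

text \<open>An \<open>N \<times> k\<close> array over the alphabet \<open>S\<close> is a function \<open>A\<close> with entry \<open>A i j\<close> in row \<open>i < N\<close>
  and column \<open>j < k\<close>; values outside this range are irrelevant. A \<open>t\<close>-tuple over \<open>S\<close> is
  indexed by the chosen set \<open>T\<close> of \<open>t\<close> columns.\<close>

definition covering_array ::
    "nat \<Rightarrow> nat \<Rightarrow> nat \<Rightarrow> nat \<Rightarrow> 'a set \<Rightarrow> (nat \<Rightarrow> nat \<Rightarrow> 'a) \<Rightarrow> bool" where
  "covering_array lam N t k S A \<longleftrightarrow>
     (\<forall>i<N. \<forall>j<k. A i j \<in> S) \<and>
     (\<forall>T. T \<subseteq> {..<k} \<and> card T = t \<longrightarrow>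
        (\<forall>x \<in> T \<rightarrow>\<^sub>E S. lam \<le> card {i. i < N \<and> (\<forall>j\<in>T. A i j = x j)}))"

text \<open>Up to renaming of symbols, every finite alphabet is a set of natural numbers. For \<open>v > 0\<close> some
  \<open>N\<close> always qualifies (list every word in \<open>S\<^sup>k\<close> exactly \<open>lam\<close> times), so \<open>LEAST\<close> is
  a genuine minimum.\<close>

definition CAN :: "nat \<Rightarrow> nat \<Rightarrow> nat \<Rightarrow> nat \<Rightarrow> nat" where
  "CAN lam t k v =
     (LEAST N. \<exists>(S :: nat set) A. finite S \<and> card S = v \<and> covering_array lam N t k S A)"

text \<open>The lower real branch \<open>W\<^sub>-\<^sub>1\<close> of the Lambert function. It is only
  meaningful for \<open>- 1 / exp 1 \<le> x < 0\<close>; elsewhere it is set to \<open>0\<close> by convention,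
  like \<open>ln\<close> outside its domain.\<close>

definition lambert_Wm1 :: "real \<Rightarrow> real" where
  "lambert_Wm1 x =
     (if - 1 / exp 1 \<le> x \<and> x < 0 then THE w. w \<le> - 1 \<and> w * exp w = x else 0)"

end

theory Submission
  imports Defs "HOL-Real_Asymp.Real_Asymp"
begin

text \<open>Fill an array row by row with the method of conditional expectations: the total demand still
  unmet after \<open>N\<close> rows is at most its expectation for random rows, and each unit of remaining demand
  is repaired by one further row. With \<open>C = k choose t\<close>, \<open>n = v\<^sup>t\<close> and \<open>q = 1 - p\<close> this gives
  \<open>CAN\<^sub>2 \<le> N + C n (2 q\<^sup>N + N p q\<^sup>N\<^sup>-\<^sup>1)\<close>
  for every natural \<open>N\<close>. The number \<open>m\<close> need not be an integer; we take \<open>N = \<lceil>m\<rceil>\<close>. The rounding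
  loss is absorbed because an interaction covered exactly once needs one extra row, while the
  claimed bound charges two. If \<open>W\<^sub>-\<^sub>1\<close> is evaluated outside its domain (which happens for \<open>k = t\<close>) and
  hence is \<open>0\<close>, then \<open>N = 0\<close> suffices.\<close>

section \<open>Covering by conditional expectations\<close>

text \<open>Expectation of \<open>max 0 (d - X)\<close> for \<open>X\<close> binomially distributed with parameters \<open>N\<close> and \<open>p\<close>;
  the truncated subtraction \<open>0 - 1 = 0\<close> is intended.\<close>

fun expected_deficit :: "real \<Rightarrow> nat \<Rightarrow> nat \<Rightarrow> real" where
  "expected_deficit p 0 d = real d"
| "expected_deficit p (Suc N) d =
     (1 - p) * expected_deficit p N d + p * expected_deficit p N (d - 1)"

lemma expected_deficit_0 [simp]: "expected_deficit p N 0 = 0"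
  by (induction N) auto

lemma expected_deficit_1: "expected_deficit p N (Suc 0) = (1 - p) ^ N"
  by (induction N) auto

lemma expected_deficit_2:
  "expected_deficit p N 2 = 2 * (1 - p) ^ N + real N * p * (1 - p) ^ (N - 1)"
proof (induction N)
  case (Suc N)
  have "expected_deficit p (Suc N) 2 =
      (1 - p) * expected_deficit p N 2 + p * (1 - p) ^ N"
    by (simp add: expected_deficit_1)
  then show ?case
    unfolding Suc.IH by (cases N) (simp_all add: algebra_simps)
qed simp

lemma exists_le_average:
  fixes f :: "'a \<Rightarrow> real"
  assumes "finite R" "R \<noteq> {}" "(\<Sum>r\<in>R. f r) = real (card R) * c"
  shows "\<exists>r\<in>R. f r \<le> c"
proof (rule ccontr)
  assume "\<not> ?thesis"
  then have "(\<Sum>r\<in>R. c) < (\<Sum>r\<in>R. f r)"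
    using assms(1,2) by (intro sum_strict_mono) auto
  then show False
    using assms(3) by simp
qed

text \<open>The recursion of \<open>expected_deficit\<close> is exactly the average over a uniformly
  random first row, which lowers the demand of each \<open>i\<close> with probability
  \<open>p\<close>. Some row \<open>r\<close> does no worse than this average, and the induction
  continues with the lowered demands; hence \<open>d\<close> must be arbitrary.\<close>

lemma exists_list_deficit_le:
  fixes M :: "'i \<Rightarrow> 'r set" and p :: real
  assumes R: "finite R" "R \<noteq> {}"
    and M: "\<And>i. i \<in> I \<Longrightarrow> M i \<subseteq> R" "\<And>i. i \<in> I \<Longrightarrow> real (card (M i)) = p * real (card R)"
  shows "\<exists>rs. length rs = N \<and> set rs \<subseteq> R \<and>
    real (\<Sum>i\<in>I. d i - length (filter (\<lambda>r. r \<in> M i) rs)) \<le> (\<Sum>i\<in>I. expected_deficit p N (d i))"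
proof (induction N arbitrary: d)
  case 0
  then show ?case by simp
next
  case (Suc N)
  let ?e = "\<lambda>r i. if r \<in> M i then d i - 1 else d i"
  have row: "(\<Sum>r\<in>R. expected_deficit p N (?e r i)) =
      real (card R) * expected_deficit p (Suc N) (d i)" if "i \<in> I" for i
  proof -
    have "(\<Sum>r\<in>R. expected_deficit p N (?e r i)) =
        (\<Sum>r\<in>M i. expected_deficit p N (d i - 1)) + (\<Sum>r\<in>R - M i. expected_deficit p N (d i))"
      using R(1) M(1)[OF that] by (subst sum.subset_diff[of "M i"]) (auto intro!: sum.cong)
    moreover have "real (card (R - M i)) = (1 - p) * real (card R)"
      using R(1) M[OF that]
      by (simp add: card_Diff_subset finite_subset card_mono of_nat_diff algebra_simps)
    ultimately show ?thesis
      using M(2)[OF that] by (simp add: algebra_simps)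
  qed
  have "(\<Sum>r\<in>R. \<Sum>i\<in>I. expected_deficit p N (?e r i)) =
      real (card R) * (\<Sum>i\<in>I. expected_deficit p (Suc N) (d i))"
    by (subst sum.swap) (simp only: row sum_distrib_left cong: sum.cong)
  from exists_le_average[OF R this] obtain r where r: "r \<in> R"
    "(\<Sum>i\<in>I. expected_deficit p N (?e r i)) \<le> (\<Sum>i\<in>I. expected_deficit p (Suc N) (d i))"
    by blast
  obtain rs where rs: "length rs = N" "set rs \<subseteq> R"
    "real (\<Sum>i\<in>I. ?e r i - length (filter (\<lambda>r. r \<in> M i) rs)) \<le>
       (\<Sum>i\<in>I. expected_deficit p N (?e r i))"
    using Suc.IH[of "?e r"] by blast
  have "(\<Sum>i\<in>I. d i - length (filter (\<lambda>r. r \<in> M i) (r # rs))) =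
      (\<Sum>i\<in>I. ?e r i - length (filter (\<lambda>r. r \<in> M i) rs))"
    by (intro sum.cong) auto
  then have "real (\<Sum>i\<in>I. d i - length (filter (\<lambda>r. r \<in> M i) (r # rs))) \<le>
      (\<Sum>i\<in>I. expected_deficit p (Suc N) (d i))"
    using rs(3) r(2) by linarith
  then show ?case
    using rs(1,2) r(1) by (intro exI[of _ "r # rs"]) auto
qed

text \<open>The repair phase is crude: for each \<open>i\<close> one fixed element of
  \<open>M i\<close> is repeated \<open>d i\<close> times.\<close>

lemma exists_list_meeting_demand:
  fixes M :: "'i \<Rightarrow> 'r set"
  assumes "finite I" "\<And>i. i \<in> I \<Longrightarrow> M i \<subseteq> R" "\<And>i. i \<in> I \<Longrightarrow> M i \<noteq> {}"
  shows "\<exists>rs. length rs = (\<Sum>i\<in>I. d i) \<and> set rs \<subseteq> R \<and>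
    (\<forall>i\<in>I. d i \<le> length (filter (\<lambda>r. r \<in> M i) rs))"
  using assms
proof (induction I rule: finite_induct)
  case (insert i I)
  then obtain rs where rs: "length rs = (\<Sum>i\<in>I. d i)" "set rs \<subseteq> R"
    "\<forall>i\<in>I. d i \<le> length (filter (\<lambda>r. r \<in> M i) rs)"
    by auto
  obtain r where "r \<in> M i" "r \<in> R"
    using insert.prems by blast
  with rs insert.hyps show ?case
    by (intro exI[of _ "replicate (d i) r @ rs"]) (auto simp: filter_replicate trans_le_add2)
qed simp

lemma card_rows_matching:
  assumes "finite J" "finite S" "T \<subseteq> J" "x \<in> T \<rightarrow>\<^sub>E S"
  shows "card {r \<in> J \<rightarrow>\<^sub>E S. \<forall>j\<in>T. r j = x j} = card S ^ (card J - card T)"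
proof -
  have "{r \<in> J \<rightarrow>\<^sub>E S. \<forall>j\<in>T. r j = x j} = PiE J (\<lambda>j. if j \<in> T then {x j} else S)"
  proof (intro set_eqI iffI)
    fix r assume "r \<in> PiE J (\<lambda>j. if j \<in> T then {x j} else S)"
    then have r: "r \<in> extensional J" "\<And>j. j \<in> J \<Longrightarrow> r j \<in> (if j \<in> T then {x j} else S)"
      by (auto simp: PiE_iff)
    have x: "r j = x j" if "j \<in> T" for j
      using r(2)[of j] that assms(3) by auto
    have "r j \<in> S" if "j \<in> J" for j
      using r(2)[OF that] x[of j] PiE_mem[OF assms(4), of j] by (cases "j \<in> T") auto
    with r(1) x show "r \<in> {r \<in> J \<rightarrow>\<^sub>E S. \<forall>j\<in>T. r j = x j}"
      by (auto simp: PiE_iff)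
  qed (auto simp: PiE_iff)
  also have "card \<dots> = (\<Prod>j\<in>J. if j \<in> T then 1 else card S)"
    by (simp add: card_PiE assms(1) if_distrib cong: if_cong)
  also have "\<dots> = (\<Prod>j\<in>J - T. card S)"
    using assms(1,3) by (intro prod.mono_neutral_cong_right) auto
  also have "\<dots> = card S ^ (card J - card T)"
    using assms(1,3) by (simp add: card_Diff_subset finite_subset)
  finally show ?thesis .
qed

text \<open>The index set \<open>I\<close> consists of the interactions \<open>(T, x)\<close>, and
  \<open>M\<close> gives the rows that cover one of them, a fraction
  \<open>v ^ (k - t) / v ^ k\<close> of all rows. The first \<open>N\<close> rows keep the total
  deficit below its expectation, and one repair row is spent per missing unit.\<close>

lemma CAN_le_expected:
  assumes "k \<ge> t" "v > 0"
  shows "real (CAN lam t k v) \<le> real N +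
    real (k choose t) * real v ^ t * expected_deficit (1 / real v ^ t) N lam"
proof -
  define p where "p = 1 / real v ^ t"
  define S where "S = {..<v}"
  define R where "R = ({..<k} \<rightarrow>\<^sub>E S)"
  define I where "I = Sigma {T. T \<subseteq> {..<k} \<and> card T = t} (\<lambda>T. T \<rightarrow>\<^sub>E S)"
  define M where "M = (\<lambda>(T, x). {r \<in> R. \<forall>j\<in>T. r j = (x j :: nat)})"
  have S: "finite S" "card S = v" "S \<noteq> {}"
    using assms(2) by (auto simp: S_def)
  have R: "finite R" "R \<noteq> {}" "card R = v ^ k"
    using S by (auto simp: R_def finite_PiE PiE_eq_empty_iff card_funcsetE)
  have finT: "finite T" if "T \<subseteq> {..<k}" for T :: "nat set"
    using that finite_subset by blast
  have finI: "finite I"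
    unfolding I_def using S(1) by (intro finite_SigmaI finite_PiE) (auto intro: finT)
  have cardI: "card I = (k choose t) * v ^ t"
  proof -
    have "card I = (\<Sum>T | T \<subseteq> {..<k} \<and> card T = t. card (T \<rightarrow>\<^sub>E S))"
      unfolding I_def using S(1) by (intro card_SigmaI) (auto intro!: finite_PiE finT)
    also have "\<dots> = (\<Sum>T | T \<subseteq> {..<k} \<and> card T = t. v ^ t)"
      using S by (intro sum.cong) (auto simp: card_funcsetE finT)
    finally show ?thesis
      by (simp add: n_subsets)
  qed
  have MR: "M i \<subseteq> R" for i
    by (auto simp: M_def split: prod.splits)
  have cardM: "card (M i) = v ^ (k - t)" if "i \<in> I" for i
    using that S(1,2) card_rows_matching[of "{..<k}" S "fst i" "snd i"]
    by (auto simp: I_def M_def R_def)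
  have M_ne: "M i \<noteq> {}" if "i \<in> I" for i
    using cardM[OF that] assms(2) by auto
  have M_frac: "real (card (M i)) = p * real (card R)" if "i \<in> I" for i
  proof -
    have "real v ^ (k - t) = real v ^ k / real v ^ t"
      using assms by (simp add: power_diff)
    then show ?thesis
      by (simp add: cardM[OF that] R(3) p_def)
  qed
  obtain rs where rs: "length rs = N" "set rs \<subseteq> R"
    "real (\<Sum>i\<in>I. lam - length (filter (\<lambda>r. r \<in> M i) rs)) \<le>
       (\<Sum>i\<in>I. expected_deficit p N lam)"
    using exists_list_deficit_le[where I = I and M = M and N = N and d = "\<lambda>_. lam",
        OF R(1,2) MR M_frac] by blast
  define d where "d = (\<lambda>i. lam - length (filter (\<lambda>r. r \<in> M i) rs))"
  obtain ys where ys: "length ys = (\<Sum>i\<in>I. d i)" "set ys \<subseteq> R"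
    "\<forall>i\<in>I. d i \<le> length (filter (\<lambda>r. r \<in> M i) ys)"
    using exists_list_meeting_demand[of I M R d, OF finI MR M_ne] by blast
  define zs where "zs = rs @ ys"
  have zsR: "set zs \<subseteq> R"
    using rs ys by (simp add: zs_def)
  have "covering_array lam (length zs) t k S (\<lambda>i. zs ! i)"
    unfolding covering_array_def
  proof (intro conjI allI impI ballI)
    fix i j assume "i < length zs" "j < k"
    then have "zs ! i \<in> R"
      using zsR nth_mem by blast
    with \<open>j < k\<close> show "(zs ! i) j \<in> S"
      by (auto simp: R_def PiE_iff)
  next
    fix T x assume T: "T \<subseteq> {..<k} \<and> card T = t" and x: "x \<in> T \<rightarrow>\<^sub>E S"
    then have I: "(T, x) \<in> I"
      by (auto simp: I_def)
    \<comment> \<open>Matches in \<open>rs\<close> and in \<open>ys\<close> add up, and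
      \<open>d\<close> is what \<open>rs\<close> leaves missing.\<close>
    have "lam \<le> length (filter (\<lambda>r. r \<in> M (T, x)) zs)"
      using ys(3) I by (fastforce simp: zs_def d_def)
    also have "\<dots> = card {i. i < length zs \<and> zs ! i \<in> M (T, x)}"
      by (rule length_filter_conv_card)
    also have "{i. i < length zs \<and> zs ! i \<in> M (T, x)} =
        {i. i < length zs \<and> (\<forall>j\<in>T. (zs ! i) j = x j)}"
      using zsR nth_mem by (auto simp: M_def)
    finally show "lam \<le> card {i. i < length zs \<and> (\<forall>j\<in>T. (zs ! i) j = x j)}" .
  qed
  then have "CAN lam t k v \<le> length zs"
    unfolding CAN_def using S by (intro Least_le) blast
  then have "real (CAN lam t k v) \<le> real N + real (\<Sum>i\<in>I. d i)"
    using rs(1) ys(1) by (simp only: zs_def length_append of_nat_le_iff flip: of_nat_add)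
  also have "real (\<Sum>i\<in>I. d i) \<le> (\<Sum>i\<in>I. expected_deficit p N lam)"
    using rs(3) by (simp add: d_def)
  finally show ?thesis
    by (simp add: cardI p_def)
qed

section \<open>The Lambert function and the choice of the number of rows\<close>

text \<open>On the half-line up to -1 the map w exp w is strictly decreasing, which gives
  uniqueness. It runs from the limit 0 at minus infinity down to -1/e at -1, so the intermediate
  value theorem gives existence.\<close>

lemma lambert_Wm1:
  assumes "- 1 / exp 1 \<le> x" "x < 0"
  shows "lambert_Wm1 x \<le> -1" "lambert_Wm1 x * exp (lambert_Wm1 x) = x"
proof -
  have dec: "b * exp b < a * exp a" if "a < b" "b \<le> -1" for a b :: real
  proof (rule DERIV_neg_imp_decreasing_open[OF that(1)])
    fix y assume "a < y" "y < b"
    then have "(1 + y) * exp y < 0"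
      using that(2) by (intro mult_neg_pos) auto
    moreover have "((\<lambda>w. w * exp w) has_real_derivative (1 + y) * exp y) (at y)"
      by (auto intro!: derivative_eq_intros simp: algebra_simps)
    ultimately show "\<exists>D. ((\<lambda>w. w * exp w) has_real_derivative D) (at y) \<and> D < 0"
      by blast
  qed (intro continuous_intros)
  have "((\<lambda>w::real. w * exp w) \<longlongrightarrow> 0) at_bot"
    by real_asymp
  then have "\<forall>\<^sub>F w in at_bot. x < w * exp w"
    using assms(2) order_tendstoD(1) by blast
  then obtain b where b: "\<And>w. w \<le> b \<Longrightarrow> x < w * exp w"
    by (auto simp: eventually_at_bot_linorder)
  have "\<exists>w\<ge>min b (-1). w \<le> -1 \<and> w * exp w = x"
    using assms(1) b[of "min b (-1)"]
    by (intro IVT2') (auto intro!: continuous_intros simp: exp_minus field_simps)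
  then have "\<exists>!w. w \<le> -1 \<and> w * exp w = x"
    using dec by (metis linorder_cases order_less_irrefl)
  from theI'[OF this] show "lambert_Wm1 x \<le> -1" "lambert_Wm1 x * exp (lambert_Wm1 x) = x"
    using assms by (simp_all add: lambert_Wm1_def)
qed

text \<open>By convexity of exp, the graph of d -> q^d lies below its chord over [0, 1]. This
  controls the factor gained by rounding \<open>m\<close> up.\<close>

lemma powr_le_linear:
  fixes q d :: real
  assumes "0 < q" "0 \<le> d" "d \<le> 1"
  shows "q powr d \<le> 1 - d * (1 - q)"
proof -
  have "exp ((1 - d) *\<^sub>R 0 + d *\<^sub>R ln q) \<le> (1 - d) * exp 0 + d * exp (ln q)"
    using assms by (intro convex_onD[OF exp_convex]) auto
  then show ?thesis
    using assms(1) by (simp add: powr_def algebra_simps)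
qed

theorem theorem6p1:
  fixes t k v :: nat and p m :: real
  assumes "k \<ge> t" and "t \<ge> 2" and "v \<ge> 2"
    and "p = 1 / real v ^ t"
    and "m = 1 / ln (1 - p) *
           (lambert_Wm1 (- exp 1 * (1 - p) ^ (v ^ t) / (2 * real (k choose t)))
            - (real v ^ t - 1) * ln (1 - p) - 1)"
  shows "real (CAN 2 t k v) \<le>
           m + 2 * real (k choose t) * real v ^ t *
             ((1 - p) powr m + m * p * (1 - p) powr (m - 1))"
proof -
  define n where "n = real v ^ t"
  define C where "C = real (k choose t)"
  define q where "q = 1 - p"
  define L where "L = - ln q"
  define x where "x = - exp 1 * (1 - p) ^ (v ^ t) / (2 * real (k choose t))"
  define w where "w = lambert_Wm1 x"
  define Q where "Q = q powr (m - 1)"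
  have "(2::real) ^ 2 \<le> 2 ^ t"
    using assms(2) by (intro power_increasing) auto
  also have "(2::real) ^ t \<le> n"
    unfolding n_def using assms(3) by (intro power_mono) auto
  finally have n: "n \<ge> 4"
    by simp
  have C: "C > 0"
    using assms(1) by (simp add: C_def)
  have pn: "p = 1 / n"
    by (simp add: assms(4) n_def)
  then have np: "n * p = 1" "n * q = n - 1"
    using n by (simp_all add: q_def field_simps)
  have q: "0 < q" "q < 1"
    using n by (simp_all add: q_def pn)
  have L: "L > 0"
    using q by (simp add: L_def)
  have L_le: "L * (n - 1) \<le> 1"
  proof -
    have "L = ln (1 / q)"
      using q by (simp add: L_def ln_div)
    also have "\<dots> \<le> 1 / q - 1"
      using q by (intro ln_le_minus_one) auto
    also have "\<dots> = 1 / (n - 1)"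
      using n by (simp add: q_def pn field_simps)
    finally show ?thesis
      using n by (simp add: field_simps)
  qed
  \<comment> \<open>The definition of \<open>m\<close> with the logarithm cleared; all later facts
    about \<open>m\<close> come from this identity.\<close>
  have mL: "L * (m + n - 1) = 1 - w"
    using assms(5) L unfolding w_def x_def
    by (fold q_def n_def) (simp add: L_def field_simps)
  have Q: "Q = exp (w - 1 + L * n)"
  proof -
    have "(m - 1) * ln q = w - 1 + L * n"
      using mL by (simp add: L_def algebra_simps)
    then show ?thesis
      using q by (simp add: Q_def powr_def)
  qed
  have powr_m: "q powr m = q * Q"
    using q by (simp add: Q_def powr_mult_base)
  have bound: "real (CAN 2 t k v) \<le> real N + C * n * expected_deficit p N 2" for N
    using CAN_le_expected[OF assms(1), of v 2 N] assms(3,4) by (simp add: C_def n_def)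
  have F: "m + 2 * real (k choose t) * real v ^ t *
      ((1 - p) powr m + m * p * (1 - p) powr (m - 1)) = m + 2 * C * Q * (m + n - 1)"
  proof -
    have "n * (q powr m + m * p * Q) = Q * (n * q + m * (n * p))"
      by (simp add: powr_m algebra_simps)
    also have "\<dots> = Q * (m + n - 1)"
      unfolding np by simp
    finally show ?thesis
      by (simp flip: q_def C_def n_def Q_def add: mult.assoc)
  qed
  show ?thesis
  proof (cases "- 1 / exp 1 \<le> x")
    case True
    have "x < 0"
      using q C by (simp add: x_def flip: q_def C_def)
    from lambert_Wm1[OF True this] have w: "w \<le> -1" "w * exp w = x"
      by (simp_all add: w_def)
    \<comment> \<open>Since L is at most 1/(n - 1), \<open>mL\<close> becomes a lower bound on
      \<open>m\<close>. With n at least 4 it yields m >= -3w >= 3, so \<open>N - 1\<close> below is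
      not truncated.\<close>
    have w_le: "- w * (n - 1) \<le> m"
    proof -
      have "(1 - w) * (n - 1) = (m + n - 1) * (L * (n - 1))"
        unfolding mL[symmetric] by simp
      moreover have "m + n - 1 > 0"
        using mL L w(1) by (metis diff_gt_0_iff_gt le_less_trans less_numeral_extra(1)
            neg_less_0_iff_less less_trans zero_less_mult_pos)
      ultimately have "(1 - w) * (n - 1) \<le> (m + n - 1) * 1"
        using L_le by (metis less_imp_le mult_left_mono)
      then show ?thesis
        by (simp add: algebra_simps)
    qed
    moreover have "- w * 3 \<le> - w * (n - 1)"
      using w(1) n by (intro mult_left_mono) auto
    ultimately have m: "- 3 * w \<le> m"
      by simp
    \<comment> \<open>The Lambert equation in disguise: by \<open>mL\<close>, the right-hand side of
      \<open>F\<close> has derivative 1 + 2CQw in \<open>m\<close>, so this says that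
      \<open>m\<close> is a stationary point.\<close>
    have CQ: "2 * C * Q * - w = 1"
    proof -
      have "(1 - p) ^ (v ^ t) = exp (- L * n)"
        using q exp_of_nat_mult[of "v ^ t" "ln q"]
        by (simp add: L_def n_def mult.commute flip: q_def)
      then have "w * exp w * (2 * C) = - exp (1 - L * n)"
        using C unfolding w(2) x_def by (simp add: C_def exp_diff exp_minus divide_simps)
      then have "w * exp w * (2 * C) * exp (L * n - 1) = - (exp (1 - L * n) * exp (L * n - 1))"
        by simp
      also have "\<dots> = - 1"
        by (simp flip: exp_add)
      finally show ?thesis
        unfolding Q by (simp add: exp_add exp_diff algebra_simps)
    qed
    define N where "N = nat \<lceil>m\<rceil>"
    define d where "d = real N - m"
    define s where "s = q powr d"
    have N: "N > 0" "0 \<le> d" "d \<le> 1"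
      using m w(1) by (simp_all add: N_def d_def) linarith+
    have s: "s \<le> 1 - d * p"
      using powr_le_linear[OF q(1) N(2,3)] by (simp add: s_def q_def)
    have "q ^ (N - 1) = q powr (m - 1 + d)"
      using q N(1) by (simp add: d_def of_nat_diff flip: powr_realpow)
    then have qN: "q ^ (N - 1) = Q * s"
      by (simp add: powr_add Q_def s_def)
    have "q ^ N = q * (Q * s)"
      using N(1) qN by (metis power_minus_mult mult.commute)
    then have "expected_deficit p N 2 = 2 * (q * (Q * s)) + real N * p * (Q * s)"
      using qN by (simp only: expected_deficit_2 flip: q_def)
    then have "n * expected_deficit p N 2 = Q * s * (2 * (n * q) + real N * (n * p))"
      by (simp only: algebra_simps)
    then have "n * expected_deficit p N 2 = Q * s * (2 * (n - 1) + m + d)"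
      unfolding np by (simp add: d_def algebra_simps)
    then have G: "real N + C * n * expected_deficit p N 2 =
        m + d + C * Q * (s * (2 * (n - 1) + m + d))"
      by (simp add: d_def mult.assoc)
    \<comment> \<open>By \<open>CQ\<close> the rounding cost \<open>d\<close> equals CQ(-2wd), so
      dividing the goal by CQ leaves this inequality. Charging singly covered interactions once
      instead of twice leaves a slack of \<open>m\<close>, which pays for -2wd.\<close>
    have key: "- 2 * w * d + s * (2 * (n - 1) + m + d) \<le> 2 * (m + n - 1)"
    proof -
      have "s * (2 * (n - 1) + m + d) \<le> (1 - d * p) * (2 * (n - 1) + m + d)"
        using s n m w(1) N(2) by (intro mult_right_mono) auto
      also have "\<dots> = 2 * (n - 1) + m + d - d * (2 * (n * p) - 2 * p) - d * p * (m + d)"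
        by (simp add: algebra_simps)
      \<comment> \<open>As p is at most 1/4, the factor 2 - 2p is at least 1, so the decay of
        \<open>s\<close> cancels the summand \<open>d\<close>.\<close>
      also have "\<dots> \<le> 2 * (n - 1) + m + d - d * 1 - 0"
        using N(2) m w(1) n
        by (intro diff_mono mult_left_mono order_refl mult_nonneg_nonneg)
          (simp_all add: np pn field_simps)
      finally have "s * (2 * (n - 1) + m + d) \<le> 2 * (n - 1) + m"
        by simp
      moreover have "- 2 * w * d \<le> - 2 * w * 1"
        using w(1) N(3) by (intro mult_left_mono) auto
      moreover have "- 2 * w * 1 \<le> m"
        using m w(1) by simp
      ultimately show ?thesis
        by argo
    qed
    have "d + C * Q * (s * (2 * (n - 1) + m + d)) =
        C * Q * (- 2 * w * d + s * (2 * (n - 1) + m + d))"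
    proof -
      have "d = 2 * C * Q * - w * d"
        unfolding CQ by simp
      then show ?thesis
        by (simp add: algebra_simps)
    qed
    also have "\<dots> \<le> C * Q * (2 * (m + n - 1))"
      using C key by (intro mult_left_mono) (auto simp: Q_def)
    also have "\<dots> = 2 * C * Q * (m + n - 1)"
      by simp
    finally show ?thesis
      unfolding F using bound[of N] G by linarith
  next
    case False
    then have w0: "w = 0"
      by (simp add: w_def lambert_Wm1_def)
    have mn: "L * (m + n - 1) = 1"
      using mL w0 by simp
    have "L * (n - 1) \<le> L * (m + n - 1)"
      using L_le mn by simp
    then have m: "m \<ge> 0"
      using L by simp
    \<comment> \<open>With w = 0 this gives Q(m + n - 1) >= n, so the claimed bound is at least 2Cn,
      the value of \<open>bound\<close> at N = 0.\<close>
    have "Q \<ge> 1 + (L * n - 1)"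
      unfolding Q w0 using exp_ge_add_one_self[of "0 - 1 + L * n"] by simp
    then have "L * n * (m + n - 1) \<le> Q * (m + n - 1)"
      using m n by (intro mult_right_mono) auto
    moreover have "L * n * (m + n - 1) = n"
      using mn by (metis mult.assoc mult.commute mult.right_neutral)
    ultimately have "C * n \<le> C * (Q * (m + n - 1))"
      using C by (intro mult_left_mono) auto
    then show ?thesis
      unfolding F using bound[of 0] m by (simp add: mult.assoc)
  qed
qed

end
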